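(* Let $I\supset[0,\infty)$ be an open interval and let $f:I\to(0,\infty)$ be a differentiable function on $I$ such that $f'\in L(a,b)$, where $0\le a<b<\infty$. Let $(\alpha,m)\in(0,1]^2$ and let $p,q>1$ with $\frac1p+\frac1q=1$. Suppose that $|f'(x)|^q$ is $(\alpha,m)$-logarithmically convex on $\left[0,\frac bm\right]$. Put $\eta=|f'(a)|\,/\,\left|f'\left(\frac bm\right)\right|^m$. Then: if $\eta=1$, $$\left|\frac{f(a)+f(b)}{2}-\frac1{b-a}\int_a^b f(x)\,dx\right|\le (b-a)\left|f'\left(\tfrac bm\right)\right|^m\left(\frac{2}{(p+1)(p+2)}\right)^{\frac1p};$$ if $\eta<1$, $$\left|\frac{f(a)+f(b)}{2}-\frac1{b-a}\int_a^b f(x)\,dx\right|\le (b-a)\left|f'\left(\tfrac bm\right)\right|^m\left(\frac{2}{(p+1)(p+2)}\right)^{\frac1p}\left(\frac{\eta^{\alpha q}-1}{\ln(\eta^{\alpha q})}\right)^{\frac1q}.$$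
   Context: For $(\alpha,m)\in(0,1]\times(0,1]$ and $c>0$, a function $g:[0,c]\to(0,\infty)$ is $(\alpha,m)$-logarithmically convex on $[0,c]$ if $g(tx+m(1-t)y)\le [g(x)]^{t^\alpha}[g(y)]^{m(1-t^\alpha)}$ for all $x,y\in[0,c]$ and $t\in[0,1]$. In particular such a function is strictly positive. $L(a,b)$ denotes the (Lebesgue) integrable functions on $(a,b)$. *)

theory Defs
  imports "HOL-Analysis.Analysis"
begin

text \<open>
  The function \<open>g\<close> is meant on \<open>{0..c}\<close> only, for \<open>c > 0\<close> and
  \<open>\<alpha>, m \<in> {0<..1}\<close>; then \<open>t * x + m * (1 - t) * y\<close> stays in \<open>{0..c}\<close>.
  The first conjunct is the codomain condition \<open>g : [0,c] \<rightarrow> (0,\<infinity>)\<close>, so \<open>powr\<close> is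
  only applied to positive values of \<open>g\<close>.
\<close>

definition alpha_m_log_convex_on :: "real \<Rightarrow> real \<Rightarrow> real \<Rightarrow> (real \<Rightarrow> real) \<Rightarrow> bool" where
  "alpha_m_log_convex_on \<alpha> m c g \<longleftrightarrow>
     (\<forall>x\<in>{0..c}. 0 < g x) \<and>
     (\<forall>x\<in>{0..c}. \<forall>y\<in>{0..c}. \<forall>t\<in>{0..1}.
        g (t * x + m * (1 - t) * y)
          \<le> g x powr (t powr \<alpha>) * g y powr (m * (1 - t powr \<alpha>)))"

end

theory Submission
  imports Defs
begin

text \<open>
  After the substitution \<open>x = t a + (1 - t) b\<close>, integrating by parts against \<open>t - 1/2\<close>
  writes the trapezoid error through \<open>f'\<close>.
  Logarithmic convexity bounds \<open>\<bar>f'(t a + (1 - t) b)\<bar>\<close> by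
  \<open>\<bar>f'(b/m)\<bar>\<^sup>m \<eta> powr (t powr \<alpha>)\<close>, hence, for \<open>\<eta> \<le> 1\<close>, by
  \<open>\<bar>f'(b/m)\<bar>\<^sup>m \<eta> powr (\<alpha> t)\<close>, whose \<open>q\<close>-th power has an explicit integral. Hoelder's inequality
  gives the constant \<open>(2 powr (-p) / (p + 1)) powr (1 / p)\<close>, which is
  smaller than the claimed one because \<open>p + 2 \<le> 2 powr (p + 1)\<close>.
\<close>

text \<open>Scale \<open>u\<close> and \<open>v\<close> by the roots \<open>A\<close> and
  \<open>B\<close> of their integrals and integrate Young's inequality pointwise: the right-hand
  side integrates to \<open>1 / p + 1 / q = 1\<close>.\<close>

lemma Hoelder_has_integral:
  fixes u v :: "'a::euclidean_space \<Rightarrow> real"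
  assumes pq: "1 < p" "1 < q" "1 / p + 1 / q = 1"
    and nonneg: "\<And>x. x \<in> S \<Longrightarrow> 0 \<le> u x" "\<And>x. x \<in> S \<Longrightarrow> 0 \<le> v x"
    and U: "((\<lambda>x. u x powr p) has_integral U) S" "0 < U"
    and V: "((\<lambda>x. v x powr q) has_integral V) S" "0 < V"
    and W: "((\<lambda>x. u x * v x) has_integral W) S"
  shows "W \<le> U powr (1 / p) * V powr (1 / q)"
proof -
  define A where "A = U powr (1 / p)"
  define B where "B = V powr (1 / q)"
  have A: "0 < A" "A powr p = U" and B: "0 < B" "B powr q = V"
    using U V pq by (auto simp: A_def B_def powr_powr)
  have le: "u x * v x / (A * B) \<le> u x powr p / (p * U) + v x powr q / (q * V)" if "x \<in> S" for x
  proof -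
    have "(u x / A) * (v x / B) \<le> (u x / A) powr p / p + (v x / B) powr q / q"
      using Youngs_inequality[of p q "u x / A" "v x / B"] pq nonneg[OF that] A B by simp
    then show ?thesis
      using nonneg[OF that] A B by (simp add: powr_divide mult.commute)
  qed
  have lhs: "((\<lambda>x. u x * v x / (A * B)) has_integral W / (A * B)) S"
    by (rule has_integral_divide[OF W])
  have rhs: "((\<lambda>x. u x powr p / (p * U) + v x powr q / (q * V)) has_integral
      U / (p * U) + V / (q * V)) S"
    by (intro has_integral_add has_integral_divide U(1) V(1))
  have "W / (A * B) \<le> U / (p * U) + V / (q * V)"
    by (rule has_integral_le[OF lhs rhs le])
  also have "\<dots> = 1 / p + 1 / q"
    using U V by simp
  finally have "W / (A * B) \<le> 1"
    using pq by simp
  then show ?thesis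
    using A B by (simp add: A_def[symmetric] B_def[symmetric] divide_le_eq)
qed

text \<open>The primitive \<open>?F\<close> is odd about \<open>1 / 2\<close>, so one formula serves
  both halves of the interval. The midpoint is passed as an exceptional point, where continuity
  suffices.\<close>

lemma has_integral_abs_centered_powr:
  fixes p :: real
  assumes "0 < p"
  shows "((\<lambda>t. \<bar>t - 1 / 2\<bar> powr p) has_integral 2 powr (-p) / (p + 1)) {0..1}"
proof -
  let ?F = "\<lambda>t::real. (t - 1 / 2) * \<bar>t - 1 / 2\<bar> powr p / (p + 1)"
  have "((\<lambda>t. \<bar>t - 1 / 2\<bar> powr p) has_integral ?F 1 - ?F 0) {0..1}"
  proof (rule fundamental_theorem_of_calculus_interior_strong[where S = "{1 / 2}"])
    show "continuous_on {0..1} ?F"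
      using assms by (intro continuous_intros continuous_on_powr') auto
    fix t :: real
    assume "t \<in> {0<..<1} - {1 / 2}"
    then have "(?F has_real_derivative \<bar>t - 1 / 2\<bar> powr p) (at t)"
    proof (cases "1 / 2 < t")
      case True
      \<comment> \<open>Away from the midpoint \<open>?F\<close> agrees locally with a signed pure
        power, and the derivative transfers from it.\<close>
      have "((\<lambda>t. (t - 1 / 2) powr (p + 1) / (p + 1)) has_real_derivative \<bar>t - 1 / 2\<bar> powr p) (at t)"
        using True assms by (auto intro!: derivative_eq_intros)
      moreover have "\<forall>\<^sub>F s in nhds t. ?F s = (s - 1 / 2) powr (p + 1) / (p + 1)"
      proof (rule eventually_mono)
        show "\<forall>\<^sub>F s in nhds t. s \<in> {1 / 2<..}"
          using True by (intro eventually_nhds_in_open) auto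
        show "?F s = (s - 1 / 2) powr (p + 1) / (p + 1)" if "s \<in> {1 / 2<..}" for s
          using that powr_mult_base[of "s - 1 / 2" p] by (simp add: add.commute)
      qed
      ultimately show ?thesis
        by - (rule iffD2[OF DERIV_cong_ev[OF refl _ refl]]; assumption)
    next
      case False
      with \<open>t \<in> _\<close> have t: "t < 1 / 2" by auto
      have "((\<lambda>t. - ((1 / 2 - t) powr (p + 1)) / (p + 1)) has_real_derivative \<bar>t - 1 / 2\<bar> powr p) (at t)"
        using t assms by (auto intro!: derivative_eq_intros)
      moreover have "\<forall>\<^sub>F s in nhds t. ?F s = - ((1 / 2 - s) powr (p + 1)) / (p + 1)"
      proof (rule eventually_mono)
        show "\<forall>\<^sub>F s in nhds t. s \<in> {..<1 / 2}"
          using t by (intro eventually_nhds_in_open) auto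
        show "?F s = - ((1 / 2 - s) powr (p + 1)) / (p + 1)" if "s \<in> {..<1 / 2}" for s
        proof -
          have "(1 / 2 - s) powr (p + 1) = (1 / 2 - s) * (1 / 2 - s) powr p"
            using that powr_mult_base[of "1 / 2 - s" p] by (simp add: add.commute)
          then show ?thesis
            using that by (simp only: mult_minus_left[symmetric]) simp
        qed
      qed
      ultimately show ?thesis
        by - (rule iffD2[OF DERIV_cong_ev[OF refl _ refl]]; assumption)
    qed
    then show "(?F has_vector_derivative \<bar>t - 1 / 2\<bar> powr p) (at t)"
      by (simp add: has_real_derivative_iff_has_vector_derivative)
  qed auto
  moreover have "?F 1 - ?F 0 = 2 powr (-p) / (p + 1)"
    by (simp add: powr_minus_divide powr_divide)
  ultimately show ?thesis by simp
qed

lemma has_integral_powr_base: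
  fixes r :: real
  assumes "0 < r" "r \<noteq> 1"
  shows "((\<lambda>t. r powr t) has_integral (r - 1) / ln r) {0..1}"
proof -
  have "((\<lambda>t. r powr t) has_integral r powr 1 / ln r - r powr 0 / ln r) {0..1}"
    using assms
    by (intro fundamental_theorem_of_calculus)
       (auto intro!: derivative_eq_intros
          simp: has_real_derivative_iff_has_vector_derivative[symmetric] powr_def)
  then show ?thesis
    using assms by (simp add: diff_divide_distrib)
qed

text \<open>The tangent bound for \<open>exp\<close> at 0 gives \<open>1 + p * ln 2\<close>, and
  \<open>ln 2\<close> exceeds \<open>1 / 2\<close>. This serves to compare the constant from
  Hoelder's inequality with the claimed one.\<close>

lemma add_two_le_two_powr:
  fixes p :: real
  assumes "0 \<le> p"
  shows "p + 2 \<le> 2 * 2 powr p"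
proof -
  have "1 + p * ln 2 \<le> 2 powr p"
    using exp_ge_add_one_self[of "p * ln 2"] by (simp add: powr_def)
  moreover have "p * (1 / 2) \<le> p * ln 2"
    using assms ln2_ge_two_thirds by (intro mult_left_mono) auto
  ultimately show ?thesis by simp
qed

text \<open>Hoelder's inequality is applied to a continuous majorant \<open>h\<close> of the
  derivative, because it is the \<open>q\<close>-th power of \<open>h\<close> whose integral is
  computable.\<close>

lemma trapezoid_error_unit_interval:
  fixes g g' h :: "real \<Rightarrow> real"
  assumes pq: "1 < p" "1 < q" "1 / p + 1 / q = 1"
    and deriv: "\<And>t. t \<in> {0..1} \<Longrightarrow> (g has_real_derivative g' t) (at t)"
    and bound: "\<And>t. t \<in> {0..1} \<Longrightarrow> \<bar>g' t\<bar> \<le> h t"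
    and h: "continuous_on {0..1} h"
    and V: "((\<lambda>t. h t powr q) has_integral V) {0..1}" "0 < V"
  shows "\<bar>(g 0 + g 1) / 2 - integral {0..1} g\<bar>
    \<le> (2 / ((p + 1) * (p + 2))) powr (1 / p) * V powr (1 / q)"
proof -
  have g_int: "g integrable_on {0..1}"
    by (intro integrable_continuous_interval continuous_at_imp_continuous_on ballI DERIV_isCont[OF deriv])
  \<comment> \<open>The weight \<open>t - 1 / 2\<close> takes the values -1/2 and 1/2 at the ends,
    so the boundary term is the mean of \<open>g 0\<close> and \<open>g 1\<close>.\<close>
  have "((\<lambda>t. g t + (t - 1 / 2) * g' t) has_integral
      (1 - 1 / 2) * g 1 - (0 - 1 / 2) * g 0) {0..1}"
  proof (rule fundamental_theorem_of_calculus)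
    fix t :: real assume "t \<in> {0..1}"
    note D = DERIV_subset[OF deriv[OF this] subset_UNIV]
    show "((\<lambda>t. (t - 1 / 2) * g t) has_vector_derivative g t + (t - 1 / 2) * g' t) (at t within {0..1})"
      unfolding has_real_derivative_iff_has_vector_derivative[symmetric]
      by (auto intro!: derivative_eq_intros D)
  qed simp
  from has_integral_diff[OF this integrable_integral[OF g_int]]
  have err: "((\<lambda>t. (t - 1 / 2) * g' t) has_integral (g 0 + g 1) / 2 - integral {0..1} g) {0..1}"
    by (simp add: add_divide_distrib add.commute)
  have uh: "(\<lambda>t. \<bar>t - 1 / 2\<bar> * h t) integrable_on {0..1}"
    by (intro integrable_continuous_interval continuous_intros h)
  have "\<bar>(g 0 + g 1) / 2 - integral {0..1} g\<bar> \<le> integral {0..1} (\<lambda>t. \<bar>t - 1 / 2\<bar> * h t)"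
    using integral_norm_bound_integral[OF has_integral_integrable[OF err] uh] bound
    by (simp add: integral_unique[OF err] abs_mult mult_left_mono)
  also have "\<dots> \<le> (2 powr (-p) / (p + 1)) powr (1 / p) * V powr (1 / q)"
    using pq bound
    by (intro Hoelder_has_integral[OF pq _ _ has_integral_abs_centered_powr _ V integrable_integral[OF uh]])
       (auto intro: order_trans[OF abs_ge_zero])
  also have "\<dots> \<le> (2 / ((p + 1) * (p + 2))) powr (1 / p) * V powr (1 / q)"
  proof (intro mult_right_mono powr_mono2)
    \<comment> \<open>With the common factor \<open>p + 1\<close> removed, the comparison of
      constants is exactly \<open>add_two_le_two_powr\<close>.\<close>
    have "1 / 2 powr p \<le> 2 / (p + 2)"
      using pq add_two_le_two_powr[of p] by (simp add: field_simps)
    then have "1 / 2 powr p / (p + 1) \<le> 2 / (p + 2) / (p + 1)"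
      using pq by (intro divide_right_mono) auto
    then show "2 powr (-p) / (p + 1) \<le> 2 / ((p + 1) * (p + 2))"
      by (simp add: powr_minus_divide mult.commute)
  qed (use pq in auto)
  finally show ?thesis .
qed

text \<open>Reduction to the unit interval. The chain rule contributes a factor of size
  \<open>b - a\<close>; together with \<open>K\<close> it passes through the \<open>q\<close>-th
  power and comes back out of the \<open>q\<close>-th root.\<close>

lemma trapezoid_error:
  fixes f f' h :: "real \<Rightarrow> real"
  assumes pq: "1 < p" "1 < q" "1 / p + 1 / q = 1"
    and ab: "a < b"
    and deriv: "\<And>x. x \<in> {a..b} \<Longrightarrow> (f has_real_derivative f' x) (at x)"
    and bound: "\<And>t. t \<in> {0..1} \<Longrightarrow> \<bar>f' (t * a + (1 - t) * b)\<bar> \<le> K * h t"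
    and K: "0 < K"
    and h: "continuous_on {0..1} h" "\<And>t. t \<in> {0..1} \<Longrightarrow> 0 \<le> h t"
    and V: "((\<lambda>t. h t powr q) has_integral V) {0..1}" "0 < V"
  shows "\<bar>(f a + f b) / 2 - 1 / (b - a) * integral {a..b} f\<bar>
    \<le> (b - a) * K * (2 / ((p + 1) * (p + 2))) powr (1 / p) * V powr (1 / q)"
proof -
  define g where "g t = f (t * a + (1 - t) * b)" for t
  have mem: "t * a + (1 - t) * b \<in> {a..b}" if "t \<in> {0..1}" for t
    using mult_nonneg_nonneg[of t "b - a"] mult_nonneg_nonneg[of "1 - t" "b - a"] that ab
    by (simp add: algebra_simps)
  have "f integrable_on {a..b}"
    by (intro integrable_continuous_interval continuous_at_imp_continuous_on ballI DERIV_isCont[OF deriv])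
  from has_integral_affinity'[OF integrable_integral[OF this[unfolded box_real[symmetric]]], of "b - a" a]
  have "((\<lambda>t. f ((b - a) * t + a)) has_integral integral {a..b} f / (b - a)) {0..1}"
    using ab by (simp add: field_simps)
  \<comment> \<open>The affine substitution runs from \<open>a\<close> to \<open>b\<close>, whereas
    \<open>g\<close> runs from \<open>b\<close> to \<open>a\<close>. A shift followed by a
    reflection replaces \<open>t\<close> by \<open>1 - t\<close>.\<close>
  from has_integral_shift_real_ivl[OF this, of 1]
  have "((\<lambda>t. f ((b - a) * (- t + 1) + a)) has_integral integral {a..b} f / (b - a)) {0..1}"
    using has_integral_reflect_real[of "\<lambda>t. f ((b - a) * (t + 1) + a)" _ 0 "-1"] by simp
  moreover have "g = (\<lambda>t. f ((b - a) * (- t + 1) + a))"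
    by (simp add: fun_eq_iff g_def algebra_simps)
  ultimately have "integral {0..1} g = integral {a..b} f / (b - a)"
    by (simp only: integral_unique)
  then have "\<bar>(f a + f b) / 2 - 1 / (b - a) * integral {a..b} f\<bar>
      = \<bar>(g 0 + g 1) / 2 - integral {0..1} g\<bar>"
    by (simp add: g_def add.commute)
  also have "\<dots> \<le> (2 / ((p + 1) * (p + 2))) powr (1 / p) * (((b - a) * K) powr q * V) powr (1 / q)"
  proof (rule trapezoid_error_unit_interval[OF pq])
    fix t :: real assume t: "t \<in> {0..1}"
    have "((\<lambda>t. t * a + (1 - t) * b) has_real_derivative a - b) (at t)"
      by (auto intro!: derivative_eq_intros)
    from DERIV_chain2[OF deriv[OF mem[OF t]] this]
    show "(g has_real_derivative f' (t * a + (1 - t) * b) * (a - b)) (at t)"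
      unfolding g_def .
    show "\<bar>f' (t * a + (1 - t) * b) * (a - b)\<bar> \<le> (b - a) * K * h t"
      using mult_left_mono[OF bound[OF t], of "b - a"] ab by (simp add: abs_mult mult_ac)
  next
    have "((\<lambda>t. ((b - a) * K) powr q * h t powr q) has_integral ((b - a) * K) powr q * V) {0..1}"
      by (rule has_integral_mult_right[OF V(1)])
    then show "((\<lambda>t. ((b - a) * K * h t) powr q) has_integral ((b - a) * K) powr q * V) {0..1}"
      by (rule has_integral_eq[rotated]) (use ab K h in \<open>auto simp: powr_mult\<close>)
  qed (use ab K V h in \<open>auto intro!: continuous_intros\<close>)
  also have "(((b - a) * K) powr q * V) powr (1 / q) = (b - a) * K * V powr (1 / q)"
    using ab K V pq by (simp add: powr_mult powr_powr)
  finally show ?thesis by (simp add: mult_ac)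
qed

text \<open>Take \<open>q\<close>-th roots in the convexity inequality and split the exponent
  \<open>m * (1 - t powr \<alpha>)\<close>; the powers with exponent \<open>t powr \<alpha>\<close>
  then collect into a ratio, which becomes \<eta> for \<open>x = a\<close> and
  \<open>y = b / m\<close>.\<close>

lemma alpha_m_log_convex_on_powr_bound:
  fixes F :: "real \<Rightarrow> real"
  assumes conv: "alpha_m_log_convex_on \<alpha> m c (\<lambda>x. F x powr q)"
    and F: "\<And>x. 0 \<le> F x" and q: "0 < q"
    and xy: "x \<in> {0..c}" "y \<in> {0..c}" and t: "t \<in> {0..1}"
  shows "F (t * x + m * (1 - t) * y) \<le> F y powr m * (F x / F y powr m) powr (t powr \<alpha>)"
proof -
  have pos: "0 < F x" "0 < F y"
  proof -
    have "0 < F x powr q" "0 < F y powr q"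
      using conv xy unfolding alpha_m_log_convex_on_def by blast+
    then show "0 < F x" "0 < F y"
      using F[of x] F[of y] by (auto simp: less_le)
  qed
  have "F (t * x + m * (1 - t) * y) powr q
      \<le> (F x powr q) powr (t powr \<alpha>) * (F y powr q) powr (m * (1 - t powr \<alpha>))"
    using conv xy t unfolding alpha_m_log_convex_on_def by blast
  also have "\<dots> = (F x powr (t powr \<alpha>) * F y powr (m * (1 - t powr \<alpha>))) powr q"
    using pos by (simp add: powr_mult powr_powr mult.commute)
  finally have "F (t * x + m * (1 - t) * y) powr q
      \<le> (F x powr (t powr \<alpha>) * F y powr (m * (1 - t powr \<alpha>))) powr q" .
  then have "F (t * x + m * (1 - t) * y) \<le> F x powr (t powr \<alpha>) * F y powr (m * (1 - t powr \<alpha>))"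
    by (rule contrapos_pp) (simp add: not_le powr_less_mono2 q)
  also have "\<dots> = F y powr m * (F x / F y powr m) powr (t powr \<alpha>)"
    using pos by (simp add: powr_divide powr_powr right_diff_distrib powr_diff)
  finally show ?thesis .
qed

theorem theorem2:
  fixes f :: "real \<Rightarrow> real" and I :: "real set"
    and a b \<alpha> m p q \<eta> :: real
  assumes I: "open I" "is_interval I" "{0..} \<subseteq> I"
    and f_pos: "\<forall>x\<in>I. 0 < f x"
    and f_diff: "f differentiable_on I"
    and ab: "0 \<le> a" "a < b"
    and f'_int: "deriv f absolutely_integrable_on {a<..<b}"
    and alpha: "0 < \<alpha>" "\<alpha> \<le> 1"
    and m: "0 < m" "m \<le> 1"
    and pq: "1 < p" "1 < q" "1 / p + 1 / q = 1"
    and conv: "alpha_m_log_convex_on \<alpha> m (b / m) (\<lambda>x. \<bar>deriv f x\<bar> powr q)"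
    and eta: "\<eta> = \<bar>deriv f a\<bar> / \<bar>deriv f (b / m)\<bar> powr m"
  shows "(\<eta> = 1 \<longrightarrow>
            \<bar>(f a + f b) / 2 - 1 / (b - a) * integral {a..b} f\<bar>
              \<le> (b - a) * \<bar>deriv f (b / m)\<bar> powr m
                  * (2 / ((p + 1) * (p + 2))) powr (1 / p)) \<and>
         (\<eta> < 1 \<longrightarrow>
            \<bar>(f a + f b) / 2 - 1 / (b - a) * integral {a..b} f\<bar>
              \<le> (b - a) * \<bar>deriv f (b / m)\<bar> powr m
                  * (2 / ((p + 1) * (p + 2))) powr (1 / p)
                  * ((\<eta> powr (\<alpha> * q) - 1) / ln (\<eta> powr (\<alpha> * q))) powr (1 / q))"
proof -
  define K where "K = \<bar>deriv f (b / m)\<bar> powr m"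
  have ab_mem: "a \<in> {0..b / m}" "b / m \<in> {0..b / m}"
    using ab m mult_left_le[of m a] by (auto simp: field_simps)
  with conv have "0 < \<bar>deriv f a\<bar> powr q" "0 < \<bar>deriv f (b / m)\<bar> powr q"
    unfolding alpha_m_log_convex_on_def by blast+
  \<comment> \<open>\<open>0 powr q\<close> is 0, so a positive power means a nonzero
    derivative.\<close>
  then have K: "0 < K" and \<eta>_pos: "0 < \<eta>"
    by (auto simp: K_def eta)
  have deriv: "(f has_real_derivative deriv f x) (at x)" if "x \<in> {a..b}" for x
  proof -
    have "x \<in> I" using that ab I(3) by auto
    then show ?thesis
      using f_diff I(1) by (simp add: DERIV_deriv_iff_real_differentiable differentiable_on_eq_differentiable_at)
  qed
  have bound: "\<bar>deriv f (t * a + (1 - t) * b)\<bar> \<le> K * \<eta> powr (\<alpha> * t)"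
    if t: "t \<in> {0..1}" and \<eta>: "\<eta> \<le> 1" for t
  proof -
    \<comment> \<open>The point \<open>b / m\<close> is chosen so that the factor \<open>m\<close>
      cancels and the argument becomes \<open>t * a + (1 - t) * b\<close>.\<close>
    have "\<bar>deriv f (t * a + (1 - t) * b)\<bar> \<le> K * \<eta> powr (t powr \<alpha>)"
      using alpha_m_log_convex_on_powr_bound[OF conv _ _ ab_mem t] pq(2) m
      by (simp add: K_def eta)
    \<comment> \<open>As \<eta> is at most 1, lowering the exponent increases the power. An exponent
      linear in \<open>t\<close> makes the \<open>q\<close>-th power an exponential in
      \<open>t\<close>.\<close>
    also have "\<dots> \<le> K * \<eta> powr (\<alpha> * t)"
    proof (intro mult_left_mono powr_mono')
      have "\<alpha> * t \<le> t powr 1"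
        using t alpha by (simp add: mult_left_le_one_le)
      also have "\<dots> \<le> t powr \<alpha>"
        using t alpha by (intro powr_mono') auto
      finally show "\<alpha> * t \<le> t powr \<alpha>" .
    qed (use \<eta> \<eta>_pos K in auto)
    finally show ?thesis .
  qed
  \<comment> \<open>\<open>V\<close> stays open because the closed form
    \<open>(r - 1) / ln r\<close> degenerates to 0 at \<open>r = 1\<close>; the two cases supply
    their own value.\<close>
  have main: "\<bar>(f a + f b) / 2 - 1 / (b - a) * integral {a..b} f\<bar>
      \<le> (b - a) * K * (2 / ((p + 1) * (p + 2))) powr (1 / p) * V powr (1 / q)"
    if \<eta>: "\<eta> \<le> 1" and V: "((\<lambda>t. (\<eta> powr (\<alpha> * q)) powr t) has_integral V) {0..1}" "0 < V" for V
  proof (rule trapezoid_error[OF pq ab(2) deriv bound K _ _ _ V(2)])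
    show "((\<lambda>t. (\<eta> powr (\<alpha> * t)) powr q) has_integral V) {0..1}"
      using V(1) by (simp add: powr_powr mult_ac)
  qed (use \<eta> \<eta>_pos in \<open>auto intro!: continuous_intros\<close>)
  show ?thesis
  proof (intro conjI impI)
    assume "\<eta> = 1"
    then show "\<bar>(f a + f b) / 2 - 1 / (b - a) * integral {a..b} f\<bar>
        \<le> (b - a) * \<bar>deriv f (b / m)\<bar> powr m * (2 / ((p + 1) * (p + 2))) powr (1 / p)"
      \<comment> \<open>For \<eta> equal to 1 the integrand is constantly 1, hence
        \<open>V = 1\<close>.\<close>
      using main[of 1] has_integral_const_real[of "1::real" 0 1] by (simp add: K_def)
  next
    assume "\<eta> < 1"
    let ?r = "\<eta> powr (\<alpha> * q)"
    have r: "0 < ?r" "?r < 1"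
      using \<open>\<eta> < 1\<close> \<eta>_pos alpha pq powr_less_mono2[of "\<alpha> * q" \<eta> 1] by auto
    \<comment> \<open>Numerator and denominator are both negative; this supplies the positivity of
      \<open>V\<close>.\<close>
    then have "0 < (?r - 1) / ln ?r"
      by (intro divide_neg_neg) (auto simp del: ln_powr)
    with main[OF _ has_integral_powr_base] r \<open>\<eta> < 1\<close>
    show "\<bar>(f a + f b) / 2 - 1 / (b - a) * integral {a..b} f\<bar>
        \<le> (b - a) * \<bar>deriv f (b / m)\<bar> powr m * (2 / ((p + 1) * (p + 2))) powr (1 / p)
          * ((?r - 1) / ln ?r) powr (1 / q)"
      by (simp add: K_def)
  qed
qed

end
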